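(* Consider the CIS synthesis process for the ReLU neural network dynamical system $f$. Upon termination of the main recursion, indicated by $\tilde{\mathcal{A}}_{i+1}(\mathcal{X}_s)=\tilde{\mathcal{A}}_i(\mathcal{X}_s)$, the output $\mathcal{C}=\tilde{\mathcal{A}}_i(\mathcal{X}_s)$ is either the empty set or a control invariant set $\mathcal{C}\subseteq\mathcal{X}_s$ that is a union of hyperboxes, $\mathcal{C}\in\mathcal{P}_\cup(\mathcal{X}_\Delta)$.
   Context: Control invariance: for an autonomous system $x_{k+1}=g(x_k)$, a non-empty $\mathcal{S}\subseteq\mathcal{X}$ is forward invariant iff for all $x_0\in\mathcal{S}$, $x_k\in\mathcal{S}$ for all $k\in\mathbb{N}$. A non-empty set $\mathcal{C}\subseteq\mathcal{X}$ is a control invariant set (CIS) for $x_{k+1}=f(x_k,u_k)$ iff there is a feedback law $u_k=\pi(x_k)\in\mathcal{U}$ such that $\mathcal{C}$ is forward invariant for $x_{k+1}=f(x_k,\pi(x_k))$. Vector inequalities and maxima are element-wise; $[a,b]$ and $]a,b[$ are closed/open hyperboxes; "hyperbox" means closed; $\mathrm{Diag}(x)$ is the diagonal matrix with diagonal $x$. Network: $\ell\ge2$, $n_0=n_x+n_u$, $n_\ell=n_x$, $W^{(i)}\in\mathbb{R}^{n_i\times n_{i-1}}$, $B^{(i)}\in\mathbb{R}^{n_i}$. $x_{k+1}=f(x_k,u_k)$: $z^{(0)}=[x_k^T,u_k^T]^T$, $\hat z^{(i)}=W^{(i)}z^{(i-1)}+B^{(i)}$, $z^{(i)}=\max\{0,\hat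 z^{(i)}\}$ ($i=1,\dots,\ell-1$), $x_{k+1}=W^{(\ell)}z^{(\ell-1)}+B^{(\ell)}$. $\mathcal{X}=[\underline{x},\overline{x}]\subset\mathbb{R}^{n_x}$, $\mathcal{U}=[\underline{u},\overline{u}]\subset\mathbb{R}^{n_u}$ are bounded hyperboxes, $f:\mathcal{X}\times\mathcal{U}\to\mathcal{X}$, and the safe set $\mathcal{X}_s\subseteq\mathcal{X}$ has non-empty interior. Quantization: fix $d_{\min}>0$. Basis hyperboxes $\mathcal{X}_\Delta^{(1)},\dots,\mathcal{X}_\Delta^{(n_\Delta)}$ are the boxes $\prod_{j=1}^{n_x}[\underline{x}_j+k_jd_{\min},\min\{\underline{x}_j+(k_j+1)d_{\min},\overline{x}_j\}]$, $k_j\in\{0,\dots,\lceil(\overline{x}_j-\underline{x}_j)/d_{\min}\rceil-1\}$; they cover $\mathcal{X}$ and have disjoint interiors. $\mathcal{P}_\cup(\mathcal{X}_\Delta)$ is the collection of all unions (including the empty one) of basis hyperboxes. The quantized safe set is $\mathcal{X}_s^\Delta=\bigcup_{i=1}^{n_s}\mathcal{X}_s^{(i)}\subseteq\mathcal{X}_s$, each $\mathcal{X}_s^{(i)}\subseteq\mathcal{X}_s$ a hyperbox in $\mathcal{P}_\cup(\mathcal{X}_\Delta)$. Interval reachability: $\texttt{lin\_layer}(a,b;W,B)=[\hat a,\hat b]$ with $\hat a_j=\sum_{q:W_{jq}\ge0}W_{jq}a_q+\sum_{q:W_{jq}<0}W_{jq}b_q+B_j$, $\hat b_j=\sum_{q:W_{jq}\ge0}W_{jq}b_q+\sum_{q:W_{jq}<0}W_{jq}a_q+B_j$.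 For hyperboxes $[x_l,x_u],[u_l,u_u]$, $\texttt{reachable\_hyperboxes}([x_l,x_u],[u_l,u_u])=\{[\hat a^{(i)},\hat b^{(i)}]\}_{i=1}^\ell$ with $a^{(0)}=[x_l^T,u_l^T]^T$, $b^{(0)}=[x_u^T,u_u^T]^T$, $[\hat a^{(i)},\hat b^{(i)}]=\texttt{lin\_layer}(a^{(i-1)},b^{(i-1)};W^{(i)},B^{(i)})$, $a^{(i)}=\max\{0,\hat a^{(i)}\}$, $b^{(i)}=\max\{0,\hat b^{(i)}\}$; $\bar{\mathcal{F}}([x_l,x_u],[u_l,u_u])=[\hat a^{(\ell)},\hat b^{(\ell)}]$. Set $\{[\underline{\hat z}^{(i)},\overline{\hat z}^{(i)}]\}_{i=1}^\ell=\texttt{reachable\_hyperboxes}(\mathcal{X},\mathcal{U})$. MILC-OP for a hyperbox $\mathcal{I}=[\underline{x}_k,\overline{x}_k]\subseteq\mathcal{X}$ and $\mathcal{T}=\mathcal{X}\setminus\bigcup_{m=1}^{n_o}]\underline{o}^{(m)},\overline{o}^{(m)}[$ (non-empty open hyperboxes): arbitrary objective; it has a solution iff there are values with (1) $a^{(0)}=[\underline{x}_k^T,u_k^T]^T$, $b^{(0)}=[\overline{x}_k^T,u_k^T]^T$, $\underline{u}\le u_k\le\overline{u}$; (2) $[\hat a^{(i)},\hat b^{(i)}]=\texttt{lin\_layer}(a^{(i-1)},b^{(i-1)};W^{(i)},B^{(i)})$, $\underline{\hat z}^{(i)}\le\hat a^{(i)}\le\hat b^{(i)}\le\overline{\hat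 z}^{(i)}$, $1\le i\le\ell$; (3) for $1\le i\le\ell-1$: $\alpha^{(i)},\beta^{(i)},\gamma^{(i)}\in\{0,1\}^{n_i}$, $\alpha^{(i)}_j+\beta^{(i)}_j+\gamma^{(i)}_j=1$, $a^{(i)}\ge\hat a^{(i)}$, $a^{(i)}\le\mathrm{Diag}(\overline{\hat z}^{(i)})\gamma^{(i)}$, $a^{(i)}\le\hat a^{(i)}-\mathrm{Diag}(\underline{\hat z}^{(i)})(\alpha^{(i)}+\beta^{(i)})$, $b^{(i)}\ge\hat b^{(i)}$, $b^{(i)}\le\hat b^{(i)}-\mathrm{Diag}(\underline{\hat z}^{(i)})\alpha^{(i)}$, $b^{(i)}\le\mathrm{Diag}(\overline{\hat z}^{(i)})(\beta^{(i)}+\gamma^{(i)})$, $0\le a^{(i)}\le b^{(i)}$; (4) $\underline{x}_{k+1}=\hat a^{(\ell)}$, $\overline{x}_{k+1}=\hat b^{(\ell)}$; (5) for $1\le m\le n_o$: $\phi^{(m)},\psi^{(m)}\in\{0,1\}^{n_x}$, $\phi^{(m)}_j+\psi^{(m)}_j\le1$, $\sum_j(\phi^{(m)}_j+\psi^{(m)}_j)\ge1$, $\overline{x}_{k+1}\le\overline{x}+\mathrm{Diag}(\underline{o}^{(m)}-\overline{x})\phi^{(m)}$, $\overline{x}_{k+1}\ge\underline{o}^{(m)}-\mathrm{Diag}(\underline{o}^{(m)}-\underline{x})\phi^{(m)}$, $\underline{x}_{k+1}\ge\underline{x}+\mathrm{Diag}(\overline{o}^{(m)}-\underline{x})\psi^{(m)}$,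 $\underline{x}_{k+1}\le\overline{o}^{(m)}-\mathrm{Diag}(\overline{o}^{(m)}-\overline{x})\psi^{(m)}$. CIS synthesis process. Sets in $\mathcal{P}_\cup(\mathcal{X}_\Delta)$ are stored as finite lists of hyperboxes from $\mathcal{P}_\cup(\mathcal{X}_\Delta)$. Verification of a list $\mathcal{I}$ against target $\mathcal{T}$: a hyperbox $\mathcal{I}_i$ of the list is put into $\mathcal{I}^-$ if $\bar{\mathcal{F}}(\mathcal{I}_i,\mathcal{U})\cap\mathcal{T}=\varnothing$; otherwise it is put into $\mathcal{I}^+$ if MILC-OP for $(\mathcal{I}_i,\mathcal{T})$ has a solution, and into $\mathcal{I}^-$ if not. $\mathcal{Q}(\mathcal{I},\mathcal{T})$: verify $\mathcal{I}$ and set $\tilde{\mathcal{R}}=\mathcal{I}^+$. While $\mathcal{I}^-$ is non-empty: each hyperbox in $\mathcal{I}^-$ with largest side length $\le d_{\min}$ is discarded, every other one is replaced by two smaller hyperboxes in $\mathcal{P}_\cup(\mathcal{X}_\Delta)$ with disjoint interiors whose union is it; then verify the new list $\mathcal{I}^-$ against $\mathcal{T}$, obtaining new $\mathcal{I}^+,\mathcal{I}^-$, and set $\tilde{\mathcal{R}}\leftarrow\tilde{\mathcal{R}}\cup\mathcal{I}^+$. Return $\mathcal{Q}(\mathcal{I},\mathcal{T})=\tilde{\mathcal{R}}$. Main recursion: $\tilde{\mathcal{A}}_0(\mathcal{X}_s)=\mathcal{X}_s^\Delta$, $\tilde{\mathcal{A}}_{i+1}(\mathcal{X}_s)=\mathcal{Q}(\tilde{\mathcal{A}}_i(\mathcal{X}_s),\tilde{\mathcal{A}}_i(\mathcal{X}_s))$,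 stopping when $\tilde{\mathcal{A}}_{i+1}(\mathcal{X}_s)=\tilde{\mathcal{A}}_i(\mathcal{X}_s)$ and returning $\mathcal{C}=\tilde{\mathcal{A}}_i(\mathcal{X}_s)$. *)

theory Defs
  imports "Jordan_Normal_Form.Matrix"
begin

section \<open>Hyperboxes\<close>

text \<open>
  Vectors of \<open>R^n\<close> are elements of \<^term>\<open>carrier_vec n :: real vec set\<close>. The library order
  \<open>\<le>\<close> on vectors is element-wise (and includes equality of dimensions), so \<^term>\<open>{a..b}\<close> is the
  closed hyperbox. The library's strict order is not element-wise and is therefore not used.
  A closed or open hyperbox is represented by the pair of its lower and upper corner.
\<close>

type_synonym box = "real vec \<times> real vec"

definition is_hyperbox :: "nat \<Rightarrow> box \<Rightarrow> bool" where
  "is_hyperbox n = (\<lambda>(a, b). a \<in> carrier_vec n \<and> b \<in> carrier_vec n \<and> a \<le> b)"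

definition closed_box :: "box \<Rightarrow> real vec set" where
  "closed_box = (\<lambda>(a, b). {a..b})"

definition open_box :: "box \<Rightarrow> real vec set" where
  "open_box = (\<lambda>(a, b). {x \<in> carrier_vec (dim_vec a). \<forall>j<dim_vec a. a $ j < x $ j \<and> x $ j < b $ j})"

definition region :: "box list \<Rightarrow> real vec set" where
  "region L = \<Union> (closed_box ` set L)"

definition max_side :: "box \<Rightarrow> real" where
  "max_side = (\<lambda>(a, b). Max {b $ j - a $ j | j. j < dim_vec a})"

text \<open>Topological interior in \<open>R^n\<close> (balls of the maximum norm); \<open>vec\<close> carries no topology.\<close>

definition interior_vec :: "nat \<Rightarrow> real vec set \<Rightarrow> real vec set" where
  "interior_vec n A = {x \<in> carrier_vec n. \<exists>e>0. \<forall>y \<in> carrier_vec n.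
     (\<forall>j<n. \<bar>y $ j - x $ j\<bar> < e) \<longrightarrow> y \<in> A}"


section \<open>Invariance\<close>

definition forward_invariant :: "'s set \<Rightarrow> ('s \<Rightarrow> 's) \<Rightarrow> 's set \<Rightarrow> bool" where
  "forward_invariant X g A \<longleftrightarrow> A \<noteq> {} \<and> A \<subseteq> X \<and> (\<forall>x0\<in>A. \<forall>k. (g ^^ k) x0 \<in> A)"

definition control_invariant :: "'s set \<Rightarrow> 'u set \<Rightarrow> ('s \<Rightarrow> 'u \<Rightarrow> 's) \<Rightarrow> 's set \<Rightarrow> bool" where
  "control_invariant X U f C \<longleftrightarrow> C \<noteq> {} \<and> C \<subseteq> X \<and>
     (\<exists>\<pi>. (\<forall>x\<in>X. \<pi> x \<in> U) \<and> forward_invariant X (\<lambda>x. f x (\<pi> x)) C)"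


section \<open>ReLU network dynamical systems\<close>

definition relu :: "real vec \<Rightarrow> real vec" where
  "relu v = map_vec (max 0) v"

record relu_system =
  state_dim :: nat
  input_dim :: nat
  depth :: nat
  width :: "nat \<Rightarrow> nat"
  weight :: "nat \<Rightarrow> real mat"
  bias :: "nat \<Rightarrow> real vec"
  state_bounds :: box
  input_bounds :: box

abbreviation state_set :: "relu_system \<Rightarrow> real vec set" where
  "state_set S \<equiv> closed_box (state_bounds S)"

abbreviation input_set :: "relu_system \<Rightarrow> real vec set" where
  "input_set S \<equiv> closed_box (input_bounds S)"

fun activation :: "relu_system \<Rightarrow> real vec \<Rightarrow> nat \<Rightarrow> real vec" where
  "activation S z0 0 = z0"
| "activation S z0 (Suc i) = relu (weight S (Suc i) *\<^sub>v activation S z0 i + bias S (Suc i))"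

definition dynamics :: "relu_system \<Rightarrow> real vec \<Rightarrow> real vec \<Rightarrow> real vec" where
  "dynamics S x u =
     weight S (depth S) *\<^sub>v activation S (x @\<^sub>v u) (depth S - 1) + bias S (depth S)"

definition valid_system :: "relu_system \<Rightarrow> bool" where
  "valid_system S \<longleftrightarrow>
     depth S \<ge> 2 \<and>
     width S 0 = state_dim S + input_dim S \<and>
     width S (depth S) = state_dim S \<and>
     (\<forall>i\<in>{1..depth S}. weight S i \<in> carrier_mat (width S i) (width S (i - 1)) \<and>
        bias S i \<in> carrier_vec (width S i)) \<and>
     is_hyperbox (state_dim S) (state_bounds S) \<and>
     is_hyperbox (input_dim S) (input_bounds S) \<and>
     (\<forall>x\<in>state_set S. \<forall>u\<in>input_set S. dynamics S x u \<in> state_set S)"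


section \<open>Quantization\<close>

definition basis_box :: "relu_system \<Rightarrow> real \<Rightarrow> (nat \<Rightarrow> nat) \<Rightarrow> box" where
  "basis_box S d k = (let n = state_dim S; (lo, hi) = state_bounds S in
     (vec n (\<lambda>j. lo $ j + real (k j) * d),
      vec n (\<lambda>j. min (lo $ j + (real (k j) + 1) * d) (hi $ j))))"

definition basis_hyperboxes :: "relu_system \<Rightarrow> real \<Rightarrow> real vec set set" where
  "basis_hyperboxes S d = (let (lo, hi) = state_bounds S in
     {closed_box (basis_box S d k) | k.
        \<forall>j<state_dim S. int (k j) \<le> \<lceil>(hi $ j - lo $ j) / d\<rceil> - 1})"

definition basis_unions :: "relu_system \<Rightarrow> real \<Rightarrow> real vec set set" where
  "basis_unions S d = {\<Union>F | F. F \<subseteq> basis_hyperboxes S d}"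

definition quantized_hyperbox :: "relu_system \<Rightarrow> real \<Rightarrow> box \<Rightarrow> bool" where
  "quantized_hyperbox S d I \<longleftrightarrow> is_hyperbox (state_dim S) I \<and> closed_box I \<in> basis_unions S d"

text \<open>The list of hyperboxes \<open>L\<close> makes up a quantized safe set for \<open>Xs\<close>.\<close>

definition quantized_safe_set :: "relu_system \<Rightarrow> real \<Rightarrow> real vec set \<Rightarrow> box list \<Rightarrow> bool" where
  "quantized_safe_set S d Xs L \<longleftrightarrow> (\<forall>I\<in>set L. quantized_hyperbox S d I \<and> closed_box I \<subseteq> Xs)"


section \<open>Interval reachability\<close>

definition lin_layer :: "box \<Rightarrow> real mat \<Rightarrow> real vec \<Rightarrow> box" where
  "lin_layer = (\<lambda>(a, b) W B. let m = dim_row W; n = dim_col W in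
     (vec m (\<lambda>j. (\<Sum>q\<in>{q. q < n \<and> W $$ (j, q) \<ge> 0}. W $$ (j, q) * a $ q)
               + (\<Sum>q\<in>{q. q < n \<and> W $$ (j, q) < 0}. W $$ (j, q) * b $ q) + B $ j),
      vec m (\<lambda>j. (\<Sum>q\<in>{q. q < n \<and> W $$ (j, q) \<ge> 0}. W $$ (j, q) * b $ q)
               + (\<Sum>q\<in>{q. q < n \<and> W $$ (j, q) < 0}. W $$ (j, q) * a $ q) + B $ j)))"

fun activation_bounds :: "relu_system \<Rightarrow> box \<Rightarrow> nat \<Rightarrow> box" where
  "activation_bounds S ab 0 = ab"
| "activation_bounds S ab (Suc i) = map_prod relu relu
     (lin_layer (activation_bounds S ab i) (weight S (Suc i)) (bias S (Suc i)))"

text \<open>The \<open>i\<close>-th pre-activation hyperbox, for \<open>1 \<le> i \<le> depth S\<close>.\<close>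

definition reachable_hyperboxes :: "relu_system \<Rightarrow> box \<Rightarrow> box \<Rightarrow> nat \<Rightarrow> box" where
  "reachable_hyperboxes S = (\<lambda>(xl, xu) (ul, uu) i.
     lin_layer (activation_bounds S (xl @\<^sub>v ul, xu @\<^sub>v uu) (i - 1)) (weight S i) (bias S i))"

definition reach_box :: "relu_system \<Rightarrow> box \<Rightarrow> box \<Rightarrow> box" where
  "reach_box S I J = reachable_hyperboxes S I J (depth S)"


section \<open>The mixed-integer problem MILC-OP\<close>

definition diag :: "real vec \<Rightarrow> real mat" where
  "diag v = mat_diag (dim_vec v) (\<lambda>j. v $ j)"

definition binary_vec :: "nat \<Rightarrow> real vec \<Rightarrow> bool" where
  "binary_vec n v \<longleftrightarrow> v \<in> carrier_vec n \<and> (\<forall>j<n. v $ j \<in> {0, 1})"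

text \<open>
  The list \<open>obs\<close> of non-empty open hyperboxes describes the target set \<open>T\<close>. A target may have
  several such descriptions, and obstacles may extend beyond the state set.
\<close>

definition obstacles_of :: "relu_system \<Rightarrow> real vec set \<Rightarrow> box list \<Rightarrow> bool" where
  "obstacles_of S T obs \<longleftrightarrow>
     (\<forall>(ol, ou)\<in>set obs. ol \<in> carrier_vec (state_dim S) \<and> ou \<in> carrier_vec (state_dim S) \<and>
        (\<forall>j<state_dim S. ol $ j < ou $ j)) \<and>
     T = state_set S - \<Union> (open_box ` set obs)"

text \<open>
  In \<open>milc_constraints\<close>, \<open>ah\<close>, \<open>bh\<close> are the pre-activation bounds and \<open>a\<close>, \<open>b\<close> the activation
  bounds, all indexed by the layer; \<open>xl'\<close>, \<open>xu'\<close> are the bounds of the successor state.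
\<close>

definition milc_constraints ::
  "relu_system \<Rightarrow> box \<Rightarrow> box list \<Rightarrow> real vec \<Rightarrow>
   (nat \<Rightarrow> real vec) \<Rightarrow> (nat \<Rightarrow> real vec) \<Rightarrow> (nat \<Rightarrow> real vec) \<Rightarrow> (nat \<Rightarrow> real vec) \<Rightarrow>
   (nat \<Rightarrow> real vec) \<Rightarrow> (nat \<Rightarrow> real vec) \<Rightarrow> (nat \<Rightarrow> real vec) \<Rightarrow>
   real vec \<Rightarrow> real vec \<Rightarrow> (nat \<Rightarrow> real vec) \<Rightarrow> (nat \<Rightarrow> real vec) \<Rightarrow> bool" where
  "milc_constraints S I obs u ah bh a b \<alpha> \<beta> \<gamma> xl' xu' \<phi> \<psi> \<longleftrightarrow>
    (let l = depth S; nx = state_dim S;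
         (xl, xu) = I; (xmin, xmax) = state_bounds S; (umin, umax) = input_bounds S;
         zl = (\<lambda>i. fst (reachable_hyperboxes S (state_bounds S) (input_bounds S) i));
         zu = (\<lambda>i. snd (reachable_hyperboxes S (state_bounds S) (input_bounds S) i))
     in
       a 0 = xl @\<^sub>v u \<and> b 0 = xu @\<^sub>v u \<and> umin \<le> u \<and> u \<le> umax \<and>
       (\<forall>i\<in>{1..l}.
          (ah i, bh i) = lin_layer (a (i - 1), b (i - 1)) (weight S i) (bias S i) \<and>
          zl i \<le> ah i \<and> ah i \<le> bh i \<and> bh i \<le> zu i) \<and>
       (\<forall>i\<in>{1..l-1}.
          binary_vec (width S i) (\<alpha> i) \<and> binary_vec (width S i) (\<beta> i) \<and>
          binary_vec (width S i) (\<gamma> i) \<and>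
          (\<forall>j<width S i. \<alpha> i $ j + \<beta> i $ j + \<gamma> i $ j = 1) \<and>
          ah i \<le> a i \<and>
          a i \<le> diag (zu i) *\<^sub>v \<gamma> i \<and>
          a i \<le> ah i - diag (zl i) *\<^sub>v (\<alpha> i + \<beta> i) \<and>
          bh i \<le> b i \<and>
          b i \<le> bh i - diag (zl i) *\<^sub>v \<alpha> i \<and>
          b i \<le> diag (zu i) *\<^sub>v (\<beta> i + \<gamma> i) \<and>
          0\<^sub>v (width S i) \<le> a i \<and> a i \<le> b i) \<and>
       xl' = ah l \<and> xu' = bh l \<and>
       (\<forall>m<length obs. let (ol, ou) = obs ! m in
          binary_vec nx (\<phi> m) \<and> binary_vec nx (\<psi> m) \<and>
          (\<forall>j<nx. \<phi> m $ j + \<psi> m $ j \<le> 1) \<and>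
          (\<Sum>j<nx. \<phi> m $ j + \<psi> m $ j) \<ge> 1 \<and>
          xu' \<le> xmax + diag (ol - xmax) *\<^sub>v \<phi> m \<and>
          ol - diag (ol - xmin) *\<^sub>v \<phi> m \<le> xu' \<and>
          xmin + diag (ou - xmin) *\<^sub>v \<psi> m \<le> xl' \<and>
          xl' \<le> ou - diag (ou - xmax) *\<^sub>v \<psi> m))"

definition milc_solvable :: "relu_system \<Rightarrow> box \<Rightarrow> box list \<Rightarrow> bool" where
  "milc_solvable S I obs \<longleftrightarrow>
     (\<exists>u ah bh a b \<alpha> \<beta> \<gamma> xl' xu' \<phi> \<psi>. milc_constraints S I obs u ah bh a b \<alpha> \<beta> \<gamma> xl' xu' \<phi> \<psi>)"


section \<open>The synthesis process\<close>

text \<open>In the following, \<open>T\<close> is the target set and \<open>obs\<close> its description by obstacles.\<close>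

definition accepted :: "relu_system \<Rightarrow> real vec set \<Rightarrow> box list \<Rightarrow> box \<Rightarrow> bool" where
  "accepted S T obs I \<longleftrightarrow>
     closed_box (reach_box S I (input_bounds S)) \<inter> T \<noteq> {} \<and> milc_solvable S I obs"

definition plus_list :: "relu_system \<Rightarrow> real vec set \<Rightarrow> box list \<Rightarrow> box list \<Rightarrow> box list" where
  "plus_list S T obs L = filter (accepted S T obs) L"

definition minus_list :: "relu_system \<Rightarrow> real vec set \<Rightarrow> box list \<Rightarrow> box list \<Rightarrow> box list" where
  "minus_list S T obs L = filter (\<lambda>I. \<not> accepted S T obs I) L"

definition bisection :: "relu_system \<Rightarrow> real \<Rightarrow> box \<Rightarrow> box \<Rightarrow> box \<Rightarrow> bool" where
  "bisection S d I I1 I2 \<longleftrightarrow>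
     quantized_hyperbox S d I1 \<and> quantized_hyperbox S d I2 \<and>
     closed_box I1 \<subset> closed_box I \<and> closed_box I2 \<subset> closed_box I \<and>
     interior_vec (state_dim S) (closed_box I1) \<inter> interior_vec (state_dim S) (closed_box I2) = {} \<and>
     closed_box I1 \<union> closed_box I2 = closed_box I"

definition replacement :: "relu_system \<Rightarrow> real \<Rightarrow> box \<Rightarrow> box list \<Rightarrow> bool" where
  "replacement S d I L \<longleftrightarrow>
     (if max_side I \<le> d then L = [] else (\<exists>I1 I2. L = [I1, I2] \<and> bisection S d I I1 I2))"

definition refinement :: "relu_system \<Rightarrow> real \<Rightarrow> box list \<Rightarrow> box list \<Rightarrow> bool" where
  "refinement S d L L' \<longleftrightarrow> (\<exists>Ls. list_all2 (replacement S d) L Ls \<and> L' = concat Ls)"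

text \<open>
  \<open>refine_loop S d T obs M R R'\<close>: the while loop, entered with rejected hyperboxes \<open>M\<close> and
  accumulated result \<open>R\<close>, can terminate with result \<open>R'\<close>. The loop is a relation because the
  choice of the two parts of a hyperbox is left open.
\<close>

inductive refine_loop ::
  "relu_system \<Rightarrow> real \<Rightarrow> real vec set \<Rightarrow> box list \<Rightarrow> box list \<Rightarrow> box list \<Rightarrow> box list \<Rightarrow> bool"
  for S d T obs where
  finished: "refine_loop S d T obs [] R R"
| iterate: "M \<noteq> [] \<Longrightarrow> refinement S d M L \<Longrightarrow>
    refine_loop S d T obs (minus_list S T obs L) (R @ plus_list S T obs L) R' \<Longrightarrow>
    refine_loop S d T obs M R R'"

text \<open>\<open>Q_result S d L T R\<close>: \<open>R\<close> is a possible result of \<open>Q(L, T)\<close>.\<close>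

definition Q_result :: "relu_system \<Rightarrow> real \<Rightarrow> box list \<Rightarrow> real vec set \<Rightarrow> box list \<Rightarrow> bool" where
  "Q_result S d L T R \<longleftrightarrow> (\<exists>obs. obstacles_of S T obs \<and>
     refine_loop S d T obs (minus_list S T obs L) (plus_list S T obs L) R)"

text \<open>The lists \<open>A 0, \<dots>, A N\<close> are the first iterates of a run of the main recursion.\<close>

definition main_recursion ::
  "relu_system \<Rightarrow> real \<Rightarrow> real vec set \<Rightarrow> (nat \<Rightarrow> box list) \<Rightarrow> nat \<Rightarrow> bool" where
  "main_recursion S d Xs A N \<longleftrightarrow>
     quantized_safe_set S d Xs (A 0) \<and>
     (\<forall>i<N. Q_result S d (A i) (region (A i)) (A (Suc i)))"

end

(* A solution of MILC-OP for a hyperbox I contains one input u that serves all states of I: the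
   binary variables force the activation bounds a, b to enclose the ReLU of every pre-activation
   between ah and bh, so the successor of every state of I under u lies between xl' and xu', and
   the obstacle constraints push this whole hyperbox out of every obstacle. At a fixed point of the
   recursion, every state lies in an accepted hyperbox, and the target is the set itself. *)
theory Submission
  imports Defs
begin

section \<open>Interval enclosures for affine layers and ReLU\<close>

text \<open>Each row sum splits by the sign of the weight. A term with nonnegative weight increases
  with its coordinate and a term with negative weight decreases, so the endpoints chosen by
  \<open>lin_layer\<close> bound every term separately.\<close>

lemma lin_layer_encloses:
  assumes "lin_layer (a, b) W B = (ah, bh)"
    and "a \<le> z" "z \<le> b" "dim_vec z = dim_col W" "dim_vec B = dim_row W"
  shows "ah \<le> W *\<^sub>v z + B" "W *\<^sub>v z + B \<le> bh"
proof -
  let ?P = "\<lambda>j. {q. q < dim_col W \<and> W $$ (j, q) \<ge> 0}"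
  let ?N = "\<lambda>j. {q. q < dim_col W \<and> W $$ (j, q) < 0}"
  have split: "(W *\<^sub>v z + B) $ j =
      (\<Sum>q\<in>?P j. W $$ (j, q) * z $ q) + (\<Sum>q\<in>?N j. W $$ (j, q) * z $ q) + B $ j"
    if j: "j < dim_row W" for j
  proof -
    have "(W *\<^sub>v z + B) $ j = (\<Sum>q<dim_col W. W $$ (j, q) * z $ q) + B $ j"
      using j assms(4,5) by (simp add: scalar_prod_def atLeast0LessThan)
    also have "{..<dim_col W} = ?P j \<union> ?N j" by auto
    also have "(\<Sum>q\<in>?P j \<union> ?N j. W $$ (j, q) * z $ q) =
        (\<Sum>q\<in>?P j. W $$ (j, q) * z $ q) + (\<Sum>q\<in>?N j. W $$ (j, q) * z $ q)"
      by (rule sum.union_disjoint) auto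
    finally show ?thesis .
  qed
  have le: "a $ q \<le> z $ q" "z $ q \<le> b $ q" if "q < dim_col W" for q
    using that assms(2-4) by (auto simp: less_eq_vec_def)
  have ah: "ah = vec (dim_row W) (\<lambda>j. (\<Sum>q\<in>?P j. W $$ (j, q) * a $ q)
      + (\<Sum>q\<in>?N j. W $$ (j, q) * b $ q) + B $ j)"
    and bh: "bh = vec (dim_row W) (\<lambda>j. (\<Sum>q\<in>?P j. W $$ (j, q) * b $ q)
      + (\<Sum>q\<in>?N j. W $$ (j, q) * a $ q) + B $ j)"
    using assms(1) by (auto simp: lin_layer_def Let_def)
  show "ah \<le> W *\<^sub>v z + B"
    unfolding less_eq_vec_def
  proof (intro conjI allI impI)
    show "dim_vec ah = dim_vec (W *\<^sub>v z + B)" using assms(5) by (simp add: ah)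
  next
    fix j assume "j < dim_vec (W *\<^sub>v z + B)"
    then have j: "j < dim_row W" using assms(5) by simp
    show "ah $ j \<le> (W *\<^sub>v z + B) $ j"
      unfolding split[OF j] ah index_vec[OF j]
      by (intro add_mono sum_mono order_refl) (auto intro: mult_left_mono mult_left_mono_neg le)
  qed
  show "W *\<^sub>v z + B \<le> bh"
    unfolding less_eq_vec_def
  proof (intro conjI allI impI)
    show "dim_vec (W *\<^sub>v z + B) = dim_vec bh" using assms(5) by (simp add: bh)
  next
    fix j assume "j < dim_vec bh"
    then have j: "j < dim_row W" by (simp add: bh)
    show "(W *\<^sub>v z + B) $ j \<le> bh $ j"
      unfolding split[OF j] bh index_vec[OF j]
      by (intro add_mono sum_mono order_refl) (auto intro: mult_left_mono mult_left_mono_neg le)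
  qed
qed

lemma lin_layer_carrier:
  "fst (lin_layer ab W B) \<in> carrier_vec (dim_row W)"
  "snd (lin_layer ab W B) \<in> carrier_vec (dim_row W)"
  by (auto simp: lin_layer_def Let_def split: prod.splits)

text \<open>Lets the \<open>diag\<close> terms of MILC-OP be read coordinate by coordinate, as
  bounds that a binary entry switches on or off.\<close>

lemma diag_mult_vec:
  assumes "dim_vec w = dim_vec v"
  shows "diag v *\<^sub>v w = vec (dim_vec v) (\<lambda>j. v $ j * w $ j)"
proof (rule eq_vecI)
  fix j assume "j < dim_vec (vec (dim_vec v) (\<lambda>j. v $ j * w $ j))"
  then have j: "j < dim_vec v" by simp
  have "(diag v *\<^sub>v w) $ j = (\<Sum>q<dim_vec v. (if j = q then v $ q else 0) * w $ q)"
    using j assms by (simp add: diag_def mat_diag_def scalar_prod_def atLeast0LessThan)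
  also have "\<dots> = (\<Sum>q<dim_vec v. if j = q then v $ q * w $ q else 0)"
    by (rule sum.cong) auto
  also have "\<dots> = v $ j * w $ j" using j by simp
  finally show "(diag v *\<^sub>v w) $ j = vec (dim_vec v) (\<lambda>j. v $ j * w $ j) $ j"
    using j by simp
qed (simp add: diag_def mat_diag_def)

text \<open>If \<gamma> is 0 in coordinate j, the first bound on \<open>a\<close> reads
  \<open>a $ j \<le> 0\<close>. If it is 1, then \<alpha> + \<beta> is 0 there and the second bound
  reads \<open>a $ j \<le> ah $ j\<close>, which is at most \<open>z $ j\<close>. Either way
  \<open>a $ j\<close> is at most the ReLU. On the other side, \<open>b\<close> dominates both
  \<open>bh\<close> and, through \<open>a\<close>, zero.\<close>

lemma relu_encloses:
  fixes ah bh z a b zl zu \<alpha> \<beta> \<gamma> :: "real vec"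
  assumes z: "z \<in> carrier_vec n" and zl: "zl \<in> carrier_vec n" and zu: "zu \<in> carrier_vec n"
    and ah: "ah \<le> z" and bh: "z \<le> bh"
    and bin: "binary_vec n \<alpha>" "binary_vec n \<beta>" "binary_vec n \<gamma>"
    and one: "\<forall>j<n. \<alpha> $ j + \<beta> $ j + \<gamma> $ j = 1"
    and a1: "a \<le> diag zu *\<^sub>v \<gamma>" and a2: "a \<le> ah - diag zl *\<^sub>v (\<alpha> + \<beta>)"
    and b1: "bh \<le> b" and b2: "0\<^sub>v n \<le> a" "a \<le> b"
  shows "a \<le> relu z" "relu z \<le> b"
proof -
  have dims: "dim_vec z = n" "dim_vec zl = n" "dim_vec zu = n" "dim_vec ah = n" "dim_vec bh = n"
    "dim_vec a = n" "dim_vec b = n" "dim_vec \<alpha> = n" "dim_vec \<beta> = n" "dim_vec \<gamma> = n"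
    using z zl zu ah bh bin b1 b2 by (auto simp: less_eq_vec_def binary_vec_def)
  have "a $ j \<le> max 0 (z $ j)" if j: "j < n" for j
  proof -
    have g: "\<gamma> $ j = 0 \<or> \<gamma> $ j = 1" using bin j by (auto simp: binary_vec_def)
    have 1: "a $ j \<le> zu $ j * \<gamma> $ j"
      using a1 j dims by (simp add: less_eq_vec_def diag_mult_vec)
    have 2: "a $ j \<le> ah $ j - zl $ j * (\<alpha> $ j + \<beta> $ j)"
      using a2 j dims by (simp add: less_eq_vec_def diag_mult_vec)
    have 3: "ah $ j \<le> z $ j" using ah j dims by (simp add: less_eq_vec_def)
    have 4: "\<alpha> $ j + \<beta> $ j = 1 - \<gamma> $ j" using one j by (simp add: algebra_simps)
    from g show ?thesis
    proof
      assume "\<gamma> $ j = 0" then show ?thesis using 1 by simp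
    next
      assume "\<gamma> $ j = 1" then show ?thesis using 2 3 4 by simp
    qed
  qed
  then show "a \<le> relu z" using dims by (auto simp: less_eq_vec_def relu_def)
  have "max 0 (z $ j) \<le> b $ j" if j: "j < n" for j
  proof -
    have "z $ j \<le> b $ j" "0 \<le> b $ j"
      using bh b1 b2 j dims by (force simp: less_eq_vec_def)+
    then show ?thesis by simp
  qed
  then show "relu z \<le> b" using dims by (auto simp: less_eq_vec_def relu_def)
qed

section \<open>Obstacle avoidance and a common input for all states of a hyperbox\<close>

text \<open>One separating coordinate suffices. Where \<phi> is 1, the bound on \<open>xu\<close>
  collapses to \<open>ol\<close>, so the box lies below the obstacle; where \<psi> is 1, the bound
  on \<open>xl\<close> collapses to \<open>ou\<close>, so it lies above. The obstacle is open, hence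
  touching its boundary is harmless.\<close>

lemma obstacle_avoided:
  fixes y xl xu ol ou xmin xmax :: "real vec"
  assumes dims: "xmin \<in> carrier_vec n" "xmax \<in> carrier_vec n" "ol \<in> carrier_vec n" "ou \<in> carrier_vec n"
    and y: "xl \<le> y" "y \<le> xu"
    and bin: "binary_vec n \<phi>" "binary_vec n \<psi>"
    and sum: "(\<Sum>j<n. \<phi> $ j + \<psi> $ j) \<ge> 1"
    and upper: "xu \<le> xmax + diag (ol - xmax) *\<^sub>v \<phi>"
    and lower: "xmin + diag (ou - xmin) *\<^sub>v \<psi> \<le> xl"
  shows "y \<notin> open_box (ol, ou)"
proof
  assume y_in: "y \<in> open_box (ol, ou)"
  have "\<exists>j<n. \<phi> $ j + \<psi> $ j \<noteq> 0"
  proof (rule ccontr)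
    assume "\<not> ?thesis"
    then have "(\<Sum>j<n. \<phi> $ j + \<psi> $ j) = 0" by (intro sum.neutral) auto
    with sum show False by simp
  qed
  \<comment> \<open>A nonzero sum of two binary entries has an entry equal to 1.\<close>
  then obtain j where j: "j < n" and "\<phi> $ j = 1 \<or> \<psi> $ j = 1"
    using bin by (force simp: binary_vec_def)
  have dim: "dim_vec \<phi> = n" "dim_vec \<psi> = n" "dim_vec xu = n" "dim_vec xl = n" "dim_vec y = n"
    using bin upper lower y dims by (auto simp: binary_vec_def less_eq_vec_def diag_def mat_diag_def)
  have in_box: "ol $ j < y $ j" "y $ j < ou $ j" using y_in j dims by (auto simp: open_box_def)
  have le: "xl $ j \<le> y $ j" "y $ j \<le> xu $ j" using y j dim by (auto simp: less_eq_vec_def)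
  from \<open>\<phi> $ j = 1 \<or> \<psi> $ j = 1\<close> show False
  proof
    assume "\<phi> $ j = 1"
    then have "xu $ j \<le> ol $ j"
      using upper j dim dims by (auto simp: less_eq_vec_def diag_mult_vec)
    with in_box le show False by linarith
  next
    assume "\<psi> $ j = 1"
    then have "ou $ j \<le> xl $ j"
      using lower j dim dims by (auto simp: less_eq_vec_def diag_mult_vec)
    with in_box le show False by linarith
  qed
qed

lemma append_vec_mono:
  fixes x x' u :: "real vec"
  assumes "x \<le> x'"
  shows "x @\<^sub>v u \<le> x' @\<^sub>v u"
  using assms by (auto simp: less_eq_vec_def)

text \<open>The input \<open>u\<close> of a solution enters both corners of layer 0 unchanged, so
  the enclosures hold for that single \<open>u\<close> and every state of the box. This gives the
  quantifier order: one input first, then all states.\<close>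

lemma milc_solvable_common_input:
  assumes S: "valid_system S" and obs: "obstacles_of S T obs"
    and I: "is_hyperbox (state_dim S) I" and I_sub: "closed_box I \<subseteq> state_set S"
    and sol: "milc_solvable S I obs"
  shows "\<exists>u\<in>input_set S. \<forall>x\<in>closed_box I. dynamics S x u \<in> T"
proof -
  obtain xl xu where Ieq: "I = (xl, xu)" by (cases I)
  obtain xmin xmax where X: "state_bounds S = (xmin, xmax)" by (cases "state_bounds S")
  obtain umin umax where U: "input_bounds S = (umin, umax)" by (cases "input_bounds S")
  define zl where "zl i = fst (reachable_hyperboxes S (state_bounds S) (input_bounds S) i)" for i
  define zu where "zu i = snd (reachable_hyperboxes S (state_bounds S) (input_bounds S) i)" for i
  define l where "l = depth S"
  from sol obtain u ah bh a b \<alpha> \<beta> \<gamma> xl' xu' \<phi> \<psi>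
    where "milc_constraints S I obs u ah bh a b \<alpha> \<beta> \<gamma> xl' xu' \<phi> \<psi>"
    unfolding milc_solvable_def by blast
  note c = this[unfolded milc_constraints_def Let_def Ieq X U prod.case,
      folded X U, folded zl_def zu_def l_def]
  \<comment> \<open>The first four constraints fix layer 0 and the input range. Then follow the
    affine layers, the activations, the two successor bounds and the obstacles.\<close>
  note c5 = c[THEN conjunct2, THEN conjunct2, THEN conjunct2, THEN conjunct2]
  note lin_c = c5[THEN conjunct1] and act_c = c5[THEN conjunct2, THEN conjunct1]
  note c7 = c5[THEN conjunct2, THEN conjunct2]
  note obst_c = c7[THEN conjunct2, THEN conjunct2, rule_format]
  have init: "a 0 = xl @\<^sub>v u" "b 0 = xu @\<^sub>v u" and u: "umin \<le> u" "u \<le> umax"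
    and succ: "xl' = ah l" "xu' = bh l"
    by (rule c[THEN conjunct1] c[THEN conjunct2, THEN conjunct1]
        c[THEN conjunct2, THEN conjunct2, THEN conjunct1]
        c[THEN conjunct2, THEN conjunct2, THEN conjunct2, THEN conjunct1]
        c7[THEN conjunct1] c7[THEN conjunct2, THEN conjunct1])+
  have lin: "lin_layer (a (i - 1), b (i - 1)) (weight S i) (bias S i) = (ah i, bh i)"
    if "i \<in> {1..l}" for i
    using bspec[OF lin_c that] by simp
  have act: "binary_vec (width S i) (\<alpha> i)" "binary_vec (width S i) (\<beta> i)"
    "binary_vec (width S i) (\<gamma> i)"
    "\<forall>j<width S i. \<alpha> i $ j + \<beta> i $ j + \<gamma> i $ j = 1"
    "a i \<le> diag (zu i) *\<^sub>v \<gamma> i" "a i \<le> ah i - diag (zl i) *\<^sub>v (\<alpha> i + \<beta> i)"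
    "bh i \<le> b i" "0\<^sub>v (width S i) \<le> a i" "a i \<le> b i" if "i \<in> {1..l-1}" for i
    using bspec[OF act_c that] by blast+
  have obst: "binary_vec (state_dim S) (\<phi> m)" "binary_vec (state_dim S) (\<psi> m)"
    "(\<Sum>j<state_dim S. \<phi> m $ j + \<psi> m $ j) \<ge> 1"
    "xu' \<le> xmax + diag (ol - xmax) *\<^sub>v \<phi> m"
    "xmin + diag (ou - xmin) *\<^sub>v \<psi> m \<le> xl'"
    if "m < length obs" "obs ! m = (ol, ou)" for m ol ou
    using obst_c[OF that(1)] by (simp_all add: that(2))
  have l2: "l \<ge> 2" and w0: "width S 0 = state_dim S + input_dim S"
    and W: "\<And>i. i \<in> {1..l} \<Longrightarrow> weight S i \<in> carrier_mat (width S i) (width S (i - 1))"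
    and B: "\<And>i. i \<in> {1..l} \<Longrightarrow> bias S i \<in> carrier_vec (width S i)"
    and Xbox: "xmin \<in> carrier_vec (state_dim S)" "xmax \<in> carrier_vec (state_dim S)"
    and Ubox: "umin \<in> carrier_vec (input_dim S)"
    and step: "\<And>x u. x \<in> state_set S \<Longrightarrow> u \<in> input_set S \<Longrightarrow> dynamics S x u \<in> state_set S"
    using S by (auto simp: valid_system_def l_def is_hyperbox_def X U)
  have u_in: "u \<in> input_set S" using u by (simp add: closed_box_def U)
  have u_dim: "dim_vec u = input_dim S" using u Ubox by (auto simp: less_eq_vec_def)
  have z_carrier: "zl i \<in> carrier_vec (width S i)" "zu i \<in> carrier_vec (width S i)"
    if "i \<in> {1..l}" for i
    using W[OF that] lin_layer_carrier[of _ "weight S i" "bias S i"]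
    by (auto simp: zl_def zu_def reachable_hyperboxes_def X U)
  have "dynamics S x u \<in> T" if x: "x \<in> closed_box I" for x
  proof -
    have xle: "xl \<le> x" "x \<le> xu" using x by (auto simp: closed_box_def Ieq)
    have x_dim: "dim_vec x = state_dim S"
      using xle I by (auto simp: Ieq is_hyperbox_def less_eq_vec_def)
    let ?z = "activation S (x @\<^sub>v u)"
    \<comment> \<open>The induction stops at the last hidden layer, since the output layer has no
      ReLU. The carrier claim supplies the dimensions needed by the affine step.\<close>
    have layers: "i \<le> l - 1 \<Longrightarrow> ?z i \<in> carrier_vec (width S i) \<and> a i \<le> ?z i \<and> ?z i \<le> b i" for i
    proof (induction i)
      case 0
      have "x @\<^sub>v u \<in> carrier_vec (width S 0)"
        by (rule carrier_vecI) (simp add: x_dim u_dim w0)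
      then show ?case using xle by (simp add: init append_vec_mono)
    next
      case (Suc i)
      then have IH: "?z i \<in> carrier_vec (width S i)" "a i \<le> ?z i" "?z i \<le> b i" by auto
      have i: "Suc i \<in> {1..l}" "Suc i \<in> {1..l-1}" using Suc.prems by auto
      note Wi = W[OF i(1), simplified] and Bi = B[OF i(1)]
      let ?h = "weight S (Suc i) *\<^sub>v ?z i + bias S (Suc i)"
      have h: "?h \<in> carrier_vec (width S (Suc i))" using mult_mat_vec_carrier[OF Wi IH(1)] Bi by simp
      \<comment> \<open>First the pre-activation is enclosed; the binary constraints then carry the
        enclosure through the ReLU.\<close>
      have enc: "ah (Suc i) \<le> ?h" "?h \<le> bh (Suc i)"
        using lin_layer_encloses[OF lin[OF i(1), simplified] IH(2,3)] IH(1) Wi Bi by auto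
      have "a (Suc i) \<le> relu ?h" "relu ?h \<le> b (Suc i)"
        using relu_encloses[OF h z_carrier[OF i(1)] enc act[OF i(2)]] by auto
      moreover have "relu ?h \<in> carrier_vec (width S (Suc i))"
        using h by (simp add: relu_def)
      ultimately show ?case by simp
    qed
    have l: "l \<in> {1..l}" using l2 by simp
    \<comment> \<open>The output layer is only affine, so one more interval step from layer
      \<open>l - 1\<close> reaches the successor state.\<close>
    have enc: "xl' \<le> dynamics S x u" "dynamics S x u \<le> xu'"
      using lin_layer_encloses[OF lin[OF l], of "?z (l - 1)"] layers[of "l - 1"] W[OF l] B[OF l]
      by (auto simp: dynamics_def l_def succ)
    have "dynamics S x u \<notin> open_box ob" if ob: "ob \<in> set obs" for ob
    proof -
      obtain m where m: "m < length obs" "obs ! m = ob" using ob by (auto simp: in_set_conv_nth)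
      obtain ol ou where oeq: "ob = (ol, ou)" by (cases ob)
      have "ol \<in> carrier_vec (state_dim S)" "ou \<in> carrier_vec (state_dim S)"
        using obs ob by (auto simp: obstacles_of_def oeq)
      then show ?thesis
        using obstacle_avoided[OF Xbox _ _ enc obst[OF m(1) m(2)[unfolded oeq]]]
        by (simp add: oeq)
    qed
    \<comment> \<open>The target is the state set minus the obstacles. Membership in the state set
      comes from the system mapping admissible pairs into it.\<close>
    moreover have "dynamics S x u \<in> state_set S" using step x I_sub u_in by blast
    ultimately show ?thesis using obs by (auto simp: obstacles_of_def)
  qed
  then show ?thesis using u_in by blast
qed

section \<open>Refinement, recursion and the quantization grid\<close>

text \<open>Each block of the concatenation stems from one hyperbox of \<open>L\<close>: it is empty
  for a discarded hyperbox and otherwise consists of two quantized parts of it.\<close>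

lemma refinement_boxes:
  assumes "refinement S d L L'" "J \<in> set L'"
  shows "quantized_hyperbox S d J \<and> (\<exists>I\<in>set L. closed_box J \<subseteq> closed_box I)"
proof -
  obtain Ls where Ls: "list_all2 (replacement S d) L Ls" "L' = concat Ls"
    using assms(1) unfolding refinement_def by blast
  with assms(2) obtain k where k: "k < length Ls" "J \<in> set (Ls ! k)"
    by (auto simp: in_set_conv_nth[of _ Ls])
  have "k < length L" "replacement S d (L ! k) (Ls ! k)"
    using Ls(1) k(1) by (auto simp: list_all2_conv_all_nth)
  with k(2) have "quantized_hyperbox S d J" "closed_box J \<subseteq> closed_box (L ! k)"
    by (auto simp: replacement_def bisection_def split: if_splits)
  with \<open>k < length L\<close> show ?thesis by (meson nth_mem)
qed

text \<open>The alternative \<open>J \<in> set R\<close> accounts for the accumulator: each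
  iteration adds only accepted parts of boxes in \<open>M\<close>. Containment in an original box
  passes through successive refinements by transitivity.\<close>

lemma refine_loop_boxes:
  assumes "refine_loop S d T obs M R R'" "J \<in> set R'"
  shows "J \<in> set R \<or> accepted S T obs J \<and> quantized_hyperbox S d J \<and>
    (\<exists>I\<in>set M. closed_box J \<subseteq> closed_box I)"
  using assms
proof (induction rule: refine_loop.induct)
  case (iterate M L R R')
  show ?case
  proof (cases "J \<in> set (R @ plus_list S T obs L)")
    case True
    then show ?thesis
      using refinement_boxes[OF iterate.hyps(2)]
      unfolding plus_list_def set_append set_filter by blast
  next
    case False
    then obtain I where "accepted S T obs J" "quantized_hyperbox S d J"
      "I \<in> set L" "closed_box J \<subseteq> closed_box I"
      using iterate.IH[OF iterate.prems] unfolding minus_list_def set_filter by blast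
    moreover obtain I' where "I' \<in> set M" "closed_box I \<subseteq> closed_box I'"
      using refinement_boxes[OF iterate.hyps(2) \<open>I \<in> set L\<close>] by blast
    ultimately show ?thesis by (meson subset_trans)
  qed
qed simp

text \<open>The initial verification splits \<open>L\<close> into accepted boxes, which start the
  accumulator, and rejected ones, which enter the loop. All acceptances refer to one description
  \<open>obs\<close> of the target.\<close>

lemma Q_result_boxes:
  assumes "Q_result S d L T R" "\<forall>I\<in>set L. quantized_hyperbox S d I"
  obtains obs where "obstacles_of S T obs"
    and "\<forall>J\<in>set R. accepted S T obs J \<and> quantized_hyperbox S d J \<and>
      (\<exists>I\<in>set L. closed_box J \<subseteq> closed_box I)"
proof -
  obtain obs where obs: "obstacles_of S T obs"
    and loop: "refine_loop S d T obs (minus_list S T obs L) (plus_list S T obs L) R"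
    using assms(1) unfolding Q_result_def by blast
  have "\<forall>J\<in>set R. accepted S T obs J \<and> quantized_hyperbox S d J \<and>
      (\<exists>I\<in>set L. closed_box J \<subseteq> closed_box I)"
    using refine_loop_boxes[OF loop] assms(2)
    unfolding plus_list_def minus_list_def set_filter by blast
  with obs show ?thesis by (rule that)
qed

text \<open>Every box of an iterate lies inside a box of the preceding one, so inclusion in
  \<open>Xs\<close> is inherited from the quantized safe set.\<close>

lemma main_recursion_boxes:
  assumes "main_recursion S d Xs A N" "k \<le> N"
  shows "\<forall>I\<in>set (A k). quantized_hyperbox S d I \<and> closed_box I \<subseteq> Xs"
  using assms(2)
proof (induction k)
  case 0
  then show ?case using assms(1) by (auto simp: main_recursion_def quantized_safe_set_def)
next
  case (Suc k)
  have Q: "Q_result S d (A k) (region (A k)) (A (Suc k))"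
    using assms(1) Suc.prems by (auto simp: main_recursion_def)
  have IH: "\<forall>I\<in>set (A k). quantized_hyperbox S d I \<and> closed_box I \<subseteq> Xs"
    using Suc by simp
  then have "\<forall>I\<in>set (A k). quantized_hyperbox S d I" by blast
  with Q obtain obs where "\<forall>J\<in>set (A (Suc k)). accepted S (region (A k)) obs J \<and>
      quantized_hyperbox S d J \<and> (\<exists>I\<in>set (A k). closed_box J \<subseteq> closed_box I)"
    by (rule Q_result_boxes)
  with IH show ?case by (meson subset_trans)
qed

lemma region_in_basis_unions:
  assumes "\<forall>I\<in>set L. quantized_hyperbox S d I"
  shows "region L \<in> basis_unions S d"
proof -
  \<comment> \<open>Taking all basis hyperboxes inside the region gives a canonical family and
    avoids choosing one for each box of \<open>L\<close>.\<close>
  have "region L = \<Union>{B \<in> basis_hyperboxes S d. B \<subseteq> region L}" (is "_ = \<Union>?F")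
  proof
    show "region L \<subseteq> \<Union>?F"
    proof
      fix x assume "x \<in> region L"
      then obtain I where I: "I \<in> set L" "x \<in> closed_box I" by (auto simp: region_def)
      obtain F where F: "F \<subseteq> basis_hyperboxes S d" "closed_box I = \<Union>F"
        using assms I(1) by (auto simp: quantized_hyperbox_def basis_unions_def)
      have "closed_box I \<subseteq> region L" using I(1) by (auto simp: region_def)
      with I(2) F show "x \<in> \<Union>?F" by blast
    qed
  qed blast
  then show ?thesis unfolding basis_unions_def by blast
qed

section \<open>From one-step inputs to a feedback law, and the fixed point\<close>

lemma control_invariantI:
  assumes "C \<noteq> {}" "C \<subseteq> X" "U \<noteq> {}" "\<And>x. x \<in> C \<Longrightarrow> \<exists>u\<in>U. f x u \<in> C"
  shows "control_invariant X U f C"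
proof -
  obtain u0 where u0: "u0 \<in> U" using assms(3) by blast
  \<comment> \<open>A feedback law must be admissible on all of \<open>X\<close>, so the fixed input
    \<open>u0\<close> serves as its value outside \<open>C\<close>.\<close>
  define \<pi> where "\<pi> x = (if x \<in> C then SOME u. u \<in> U \<and> f x u \<in> C else u0)" for x
  have pi: "\<pi> x \<in> U \<and> f x (\<pi> x) \<in> C" if "x \<in> C" for x
    using someI_ex[of "\<lambda>u. u \<in> U \<and> f x u \<in> C"] assms(4)[OF that] that by (auto simp: \<pi>_def)
  have "((\<lambda>x. f x (\<pi> x)) ^^ k) x \<in> C" if "x \<in> C" for x k
    using that pi by (induction k) auto
  moreover have "\<pi> x \<in> U" for x using pi u0 by (cases "x \<in> C") (auto simp: \<pi>_def)
  ultimately show ?thesis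
    using assms(1,2) unfolding control_invariant_def forward_invariant_def by blast
qed

theorem mainTheorem11:
  fixes S :: relu_system and d_min :: real and Xs :: "real vec set"
    and A :: "nat \<Rightarrow> box list" and i :: nat
  assumes "valid_system S"
    and "d_min > 0"
    and "Xs \<subseteq> state_set S"
    and "interior_vec (state_dim S) Xs \<noteq> {}"
    and "main_recursion S d_min Xs A (Suc i)"
    and "region (A (Suc i)) = region (A i)"
  shows "region (A i) = {} \<or>
    (control_invariant (state_set S) (input_set S) (dynamics S) (region (A i)) \<and>
     region (A i) \<subseteq> Xs \<and>
     region (A i) \<in> basis_unions S d_min)"
proof -
  let ?C = "region (A i)"
  note boxes = main_recursion_boxes[OF assms(5)]
  have quant: "\<forall>I\<in>set (A i). quantized_hyperbox S d_min I" using boxes[of i] by simp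
  have sub: "?C \<subseteq> Xs" using boxes[of i] by (auto simp: region_def)
  have "Q_result S d_min (A i) ?C (A (Suc i))"
    using assms(5) by (simp add: main_recursion_def)
  from this quant obtain obs where obs: "obstacles_of S ?C obs"
    and acc: "\<forall>J\<in>set (A (Suc i)). accepted S ?C obs J \<and> quantized_hyperbox S d_min J \<and>
      (\<exists>I\<in>set (A i). closed_box J \<subseteq> closed_box I)"
    by (rule Q_result_boxes)
  have step: "\<exists>u\<in>input_set S. dynamics S x u \<in> ?C" if x: "x \<in> ?C" for x
  proof -
    \<comment> \<open>The two lists may differ although their regions agree. Acceptance is known for
      the boxes of \<open>A (Suc i)\<close>, so the box around \<open>x\<close> is taken from there,
      while the target is the region of \<open>A i\<close>.\<close>
    obtain J where J: "J \<in> set (A (Suc i))" "x \<in> closed_box J"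
      using x unfolding assms(6)[symmetric] unfolding region_def by blast
    have "is_hyperbox (state_dim S) J" "milc_solvable S J obs"
      using acc J(1) by (auto simp: accepted_def quantized_hyperbox_def)
    moreover have "closed_box J \<subseteq> state_set S"
      using boxes[of "Suc i"] J(1) assms(3) by auto
    ultimately show ?thesis
      using milc_solvable_common_input[OF assms(1) obs] J(2) by blast
  qed
  \<comment> \<open>The corners of the input hyperbox are ordered, so it contains them; this
    supplies the default input.\<close>
  have "input_set S \<noteq> {}"
    using assms(1) by (auto simp: valid_system_def is_hyperbox_def closed_box_def)
  then have "control_invariant (state_set S) (input_set S) (dynamics S) ?C" if "?C \<noteq> {}"
    using that sub assms(3) step by (intro control_invariantI) auto
  then show ?thesis using sub region_in_basis_unions[OF quant] by blast
qed

end
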